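(* Let $\sigma\in\mathbb{R}^p$. Let $\mathcal{I}\subset\mathbb{R}^p$ be an open neighborhood of $\sigma$ and let $\varsigma\in\mathcal{I}\mapsto K_\varsigma\in\mathbb{R}^{m\times n}$ and $\varsigma\in\mathcal{I}\mapsto L_\varsigma\in\mathbb{R}^{n\times\ell}$ be continuous with $\varrho(\mathcal{A}_\sigma+\mathcal{B}_\sigma K_\sigma)<1$ and $\varrho(\mathcal{A}_\sigma+L_\sigma C)<1$. Let $\mathcal{I}'\subset\mathcal{I}$ be a neighborhood of $\sigma$ with $\varrho(F(\sigma,\varsigma))<1$ for all $\varsigma\in\mathcal{I}'$, and let $\widehat\sigma\in\mathcal{I}'$. Consider the coupled system $$y_{j+1}=\mathcal{A}_\sigma y_j+\mathcal{B}_\sigma K_{\widehat\sigma}\widehat y_j,\qquad z_j=Cy_j+\eta_j,\qquad \widehat y_{j+1}=\mathcal{A}_{\widehat\sigma}\widehat y_j+\mathcal{B}_{\widehat\sigma}K_{\widehat\sigma}\widehat y_j+L_{\widehat\sigma}(C\widehat y_j-z_j),\qquad j\ge 0,$$ where $y_0\sim\mathcal{N}(m_0,\mathcal{C}_0)$, $\eta_j\sim\mathcal{N}(0,\Gamma_j)$, the random vectors $y_0,\eta_0,\eta_1,\dots$ are mutually independent, $\Gamma_j\to\Gamma_\infty$ as $j\to\infty$, and $\widehat y_0=m_0$. Set $e_j=y_j-\widehat y_j$ and $X_j=\begin{bmatrix}y_j\\ e_j\end{bmatrix}$, and write $F=F(\sigma,\widehat\sigma)$. Then for every $j\ge 1$,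 $X_j$ is normally distributed, $X_j\sim\mathcal{N}\left(F^j\begin{bmatrix}m_0\\0\end{bmatrix},\mathbf{\Pi}_j\right)$, where $$\mathbf{\Pi}_j=F^j\,\mathbf{\Pi}_0\,(F^\top)^j+\sum_{k=0}^{j-1}F^{j-1-k}\begin{bmatrix}0\\L_{\widehat\sigma}\end{bmatrix}\Gamma_k\begin{bmatrix}0\\L_{\widehat\sigma}\end{bmatrix}^\top(F^\top)^{j-1-k},\qquad \mathbf{\Pi}_0=\begin{bmatrix}\mathcal{C}_0&\mathcal{C}_0\\ \mathcal{C}_0&\mathcal{C}_0\end{bmatrix}.$$ Further, as $j\to\infty$, the pair $(y_j,e_j)$ converges in distribution to $(y_\infty,e_\infty)\sim\mathcal{N}(0,\mathbf{\Pi}_\infty)$, where $\mathbf{\Pi}_\infty$ is the unique solution of the Lyapunov equation $$\mathbf{\Pi}_\infty=F\,\mathbf{\Pi}_\infty F^\top+\begin{bmatrix}0\\L_{\widehat\sigma}\end{bmatrix}\Gamma_\infty\begin{bmatrix}0\\L_{\widehat\sigma}\end{bmatrix}^\top.$$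
   Context: Fix positive integers $n,m,\ell,p$, matrices $B\in\mathbb{R}^{n\times m}$ and $C\in\mathbb{R}^{\ell\times n}$, a time step $\Delta t>0$, and a family of matrices $A_\varsigma\in\mathbb{R}^{n\times n}$ depending continuously on $\varsigma\in\mathbb{R}^p$. Define $$\mathcal{A}_\varsigma = e^{A_\varsigma\Delta t},\qquad \mathcal{B}_\varsigma=\int_0^{\Delta t}e^{A_\varsigma(\Delta t-\tau)}\,\mathrm{d}\tau\,B.$$ $\varrho(M)$ denotes the spectral radius of a square matrix $M$. For $\varsigma\in\mathcal{I}$, $$F(\sigma,\varsigma)=\begin{bmatrix}\mathcal{A}_\sigma+\mathcal{B}_\sigma K_\varsigma & -\mathcal{B}_\sigma K_\varsigma\\ \mathcal{A}_\sigma-\mathcal{A}_\varsigma+(\mathcal{B}_\sigma-\mathcal{B}_\varsigma)K_\varsigma & \mathcal{A}_\varsigma+L_\varsigma C-(\mathcal{B}_\sigma-\mathcal{B}_\varsigma)K_\varsigma\end{bmatrix}\in\mathbb{R}^{2n\times 2n}.$$ $\mathcal{N}(\mu,\Sigma)$ is the (possibly degenerate) Gaussian distribution with mean $\mu$ and symmetric positive semidefinite covariance $\Sigma$; the noise covariances $\Gamma_j\in\mathbb{R}^{\ell\times\ell}$ are symmetric positive definite. Convergence in distribution of Gaussian random vectors $X_k\sim\mathcal{N}(\mu_k,\Sigma_k)$ to $X\sim\mathcal{N}(\mu,\Sigma)$ means that $\mu_k\to\mu$ and $\Sigma_k\to\Sigma$ (for Gaussian vectors this is equivalent to the usual definition).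 *)

theory Defs
  imports "HOL-Probability.Probability"
begin

text \<open>The type \<^typ>\<open>real^'n^'n\<close> carries the componentwise multiplication, so the library's
  power and exponential are not the matrix ones.\<close>

primrec matpow :: "real^'n^'n \<Rightarrow> nat \<Rightarrow> real^'n^'n" where
  "matpow M 0 = mat 1"
| "matpow M (Suc k) = M ** matpow M k"

definition matexp :: "real^'n^'n \<Rightarrow> real^'n^'n" where
  "matexp M = (\<Sum>k. (1 / fact k) *\<^sub>R matpow M k)"

definition spec_radius :: "real^'n^'n \<Rightarrow> real" where
  "spec_radius M =
     Max (cmod ` {c. \<exists>v::complex^'n. v \<noteq> 0 \<and> (\<chi> i j. complex_of_real (M $ i $ j)) *v v = c *s v})"

definition stack_vec :: "real^'a \<Rightarrow> real^'b \<Rightarrow> real^('a + 'b)" where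
  "stack_vec u v = (\<chi> i. case i of Inl a \<Rightarrow> u $ a | Inr b \<Rightarrow> v $ b)"

definition stack_mat :: "real^'c^'a \<Rightarrow> real^'c^'b \<Rightarrow> real^'c^('a + 'b)" where
  "stack_mat P Q = (\<chi> i. case i of Inl a \<Rightarrow> P $ a | Inr b \<Rightarrow> Q $ b)"

text \<open>\<open>block_mat P Q R S\<close> has first block row \<open>P Q\<close> and second block row \<open>R S\<close>.\<close>

definition block_mat ::
    "real^'c^'a \<Rightarrow> real^'d^'a \<Rightarrow> real^'c^'b \<Rightarrow> real^'d^'b \<Rightarrow> real^('c + 'd)^('a + 'b)" where
  "block_mat P Q R S =
     (\<chi> i. case i of Inl a \<Rightarrow> stack_vec (P $ a) (Q $ a) | Inr b \<Rightarrow> stack_vec (R $ b) (S $ b))"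

definition sym_psd :: "real^'d^'d \<Rightarrow> bool" where
  "sym_psd S \<longleftrightarrow> transpose S = S \<and> (\<forall>x. x \<bullet> (S *v x) \<ge> 0)"

definition sym_pd :: "real^'d^'d \<Rightarrow> bool" where
  "sym_pd S \<longleftrightarrow> transpose S = S \<and> (\<forall>x. x \<noteq> 0 \<longrightarrow> x \<bullet> (S *v x) > 0)"

definition disc_A :: "real \<Rightarrow> real^'n^'n \<Rightarrow> real^'n^'n" where
  "disc_A dt A = matexp (dt *\<^sub>R A)"

definition disc_B :: "real \<Rightarrow> real^'n^'n \<Rightarrow> real^'m^'n \<Rightarrow> real^'m^'n" where
  "disc_B dt A B = integral {0..dt} (\<lambda>\<tau>. matexp ((dt - \<tau>) *\<^sub>R A)) ** B"

definition closed_loop ::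
    "real \<Rightarrow> ('p \<Rightarrow> real^'n^'n) \<Rightarrow> real^'m^'n \<Rightarrow> real^'n^'l \<Rightarrow>
     ('p \<Rightarrow> real^'n^'m) \<Rightarrow> ('p \<Rightarrow> real^'l^'n) \<Rightarrow> 'p \<Rightarrow> 'p \<Rightarrow> real^('n + 'n)^('n + 'n)" where
  "closed_loop dt A B C K L s r =
     (let As = disc_A dt (A s); Ar = disc_A dt (A r);
          Bs = disc_B dt (A s) B; Br = disc_B dt (A r) B
      in block_mat
           (As + Bs ** K r)                 (- (Bs ** K r))
           (As - Ar + (Bs - Br) ** K r)     (Ar + L r ** C - (Bs - Br) ** K r))"

text \<open>The second argument is the variance; variance \<open>0\<close> gives the point mass.\<close>

definition gaussian_real :: "real \<Rightarrow> real \<Rightarrow> real measure" where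
  "gaussian_real \<mu> v =
     (if v = 0 then return borel \<mu> else density lborel (\<lambda>x. ennreal (normal_density \<mu> (sqrt v) x)))"

text \<open>A random vector is Gaussian when all its one-dimensional projections are; this covers
  singular covariance matrices, for which there is no Lebesgue density.\<close>

definition gaussian_vec ::
    "'w measure \<Rightarrow> ('w \<Rightarrow> real^'d) \<Rightarrow> real^'d \<Rightarrow> real^'d^'d \<Rightarrow> bool" where
  "gaussian_vec M X \<mu> S \<longleftrightarrow>
     X \<in> borel_measurable M \<and> sym_psd S \<and>
     (\<forall>a. distr M borel (\<lambda>w. a \<bullet> X w) = gaussian_real (a \<bullet> \<mu>) (a \<bullet> (S *v a)))"

text \<open>Convergence in distribution of Gaussian vectors, in terms of means and covariances.
  The limit may live on another probability space.\<close>

definition gaussian_converges ::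
    "'w measure \<Rightarrow> (nat \<Rightarrow> 'w \<Rightarrow> real^'d) \<Rightarrow> 'v measure \<Rightarrow> ('v \<Rightarrow> real^'d) \<Rightarrow> bool" where
  "gaussian_converges M X N Y \<longleftrightarrow>
     (\<exists>\<mu> S \<mu>' S'. (\<forall>k. gaussian_vec M (X k) (\<mu> k) (S k)) \<and> gaussian_vec N Y \<mu>' S' \<and>
        \<mu> \<longlonglongrightarrow> \<mu>' \<and> S \<longlonglongrightarrow> S')"

text \<open>Mutual independence of one variable and a sequence of variables with values in a different
  type. The library's \<open>indep_vars\<close> needs a common type of values, so this is its unfolding
  into the generated sigma-algebras.\<close>

definition indep_with_seq ::
    "'w measure \<Rightarrow> ('w \<Rightarrow> 'a::topological_space) \<Rightarrow> (nat \<Rightarrow> 'w \<Rightarrow> 'b::topological_space) \<Rightarrow> bool" where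
  "indep_with_seq M X Y \<longleftrightarrow>
     X \<in> borel_measurable M \<and> (\<forall>j. Y j \<in> borel_measurable M) \<and>
     prob_space.indep_sets M
       (case_option {X -` D \<inter> space M | D. D \<in> sets borel}
          (\<lambda>j. {Y j -` D \<inter> space M | D. D \<in> sets borel}))
       UNIV"

end

theory Submission
  imports Defs "HOL-Computational_Algebra.Fundamental_Theorem_Algebra"
begin

text \<open>
  The stacked state satisfies \<open>X\<^sub>j\<^sub>+\<^sub>1 = F X\<^sub>j + G \<eta>\<^sub>j\<close>, so \<open>X\<^sub>j\<close> is a sum of independent affine images of
  \<open>y\<^sub>0\<close> and of the \<open>\<eta>\<^sub>k\<close>. Characteristic functions of the one-dimensional projections show that such a
  sum is Gaussian, also when covariances are singular.

  If \<open>\<rho>(F) < r < 1\<close>, then \<open>r\<^bsup>-k\<^esup> F\<^sup>k \<longlongrightarrow> 0\<close>; this needs neither the Jordan form nor the Cayley-Hamilton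
  theorem, since linear dependence of the powers of \<open>F\<close> already gives an annihilating polynomial,
  which is then split into linear factors over the complex numbers. Consequently \<open>P \<mapsto> P - F P F\<^sup>T\<close> is
  injective, hence bijective, on the space of matrices, which solves the Lyapunov equation, and the
  difference of \<open>\<Pi>\<^sub>j\<close> and its solution obeys \<open>D\<^sub>j\<^sub>+\<^sub>1 = F D\<^sub>j F\<^sup>T + E\<^sub>j\<close> with \<open>E\<^sub>j \<longlongrightarrow> 0\<close>, so it tends to \<open>0\<close>.

  The limit covariance is positive semidefinite, hence a sum of rank-one matrices \<open>v\<^sub>i v\<^sub>i\<^sup>T\<close> by the
  Cholesky elimination; combining the \<open>v\<^sub>i\<close> with independent standard normal coefficients gives a
  Gaussian vector with that covariance.
\<close>

section \<open>Gaussian vectors\<close>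

lemma inner_matrix_vector_mult_right:
  fixes A :: "real^'n^'m"
  shows "x \<bullet> (A *v y) = (transpose A *v x) \<bullet> y"
  by (simp add: dot_lmul_matrix transpose_matrix_vector)

lemma quadratic_form_congruence:
  fixes T :: "real^'n^'m"
  shows "x \<bullet> ((T ** S ** transpose T) *v x) = (transpose T *v x) \<bullet> (S *v (transpose T *v x))"
  by (simp add: matrix_vector_mul_assoc [symmetric] inner_matrix_vector_mult_right)

lemma sym_psd_congruence:
  "sym_psd S \<Longrightarrow> sym_psd (T ** S ** transpose T)"
  unfolding sym_psd_def quadratic_form_congruence
  by (simp add: matrix_transpose_mul matrix_mul_assoc)

lemma sum_matrix_vector_mult:
  fixes S :: "'i \<Rightarrow> real^'n^'m"
  shows "(\<Sum>i\<in>I. S i) *v x = (\<Sum>i\<in>I. S i *v x)"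
  by (induction I rule: infinite_finite_induct) (simp_all add: matrix_vector_mult_add_rdistrib)

lemma sym_psd_sum:
  fixes S :: "'i \<Rightarrow> real^'n^'n"
  assumes "\<And>i. i \<in> I \<Longrightarrow> sym_psd (S i)"
  shows "sym_psd (\<Sum>i\<in>I. S i)"
  using assms
  by (auto simp: sym_psd_def sum_matrix_vector_mult inner_sum_right vec_eq_iff transpose_def
      intro!: sum_nonneg sum.cong)

text \<open>The case split in \<open>gaussian_real\<close> is resolved once here: for variance
  \<open>0\<close> the affine map is constant and gives the point mass. Afterwards degenerate and
  nondegenerate laws are treated alike.\<close>

lemma gaussian_real_eq_distr:
  assumes "0 \<le> v"
  shows "gaussian_real \<mu> v = distr std_normal_distribution borel (\<lambda>x. \<mu> + sqrt v * x)"
proof -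
  interpret P: prob_space std_normal_distribution
    by (rule prob_space_normal_density) simp
  show ?thesis
  proof (cases "v = 0")
    case True
    then show ?thesis by (simp add: gaussian_real_def)
  next
    case False
    with assms have "0 < v" by simp
    have "distributed std_normal_distribution lborel (\<lambda>x. x) std_normal_density"
      by (auto simp: distributed_def intro!: distr_id2)
    then have "distributed std_normal_distribution lborel (\<lambda>x. \<mu> + sqrt v * x)
        (normal_density (\<mu> + sqrt v * 0) (\<bar>sqrt v\<bar> * 1))"
      by (rule P.normal_density_affine) (use \<open>0 < v\<close> in auto)
    then have "distr std_normal_distribution lborel (\<lambda>x. \<mu> + sqrt v * x)
        = density lborel (normal_density \<mu> (sqrt v))"
      using \<open>0 < v\<close> by (simp add: distributed_def)
    moreover have "distr std_normal_distribution lborel (\<lambda>x. \<mu> + sqrt v * x)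
        = distr std_normal_distribution borel (\<lambda>x. \<mu> + sqrt v * x)"
      by (rule distr_cong) auto
    ultimately show ?thesis
      using False by (simp add: gaussian_real_def)
  qed
qed

lemma real_distribution_gaussian_real:
  "0 \<le> v \<Longrightarrow> real_distribution (gaussian_real \<mu> v)"
  unfolding gaussian_real_eq_distr
  by (intro prob_space.real_distribution_distr prob_space_normal_density) auto

lemma char_gaussian_real:
  assumes "0 \<le> v"
  shows "char (gaussian_real \<mu> v) t = exp (\<i> * of_real (t * \<mu>) - of_real (v * t\<^sup>2 / 2))"
proof -
  have "char (gaussian_real \<mu> v) t
      = (CLINT x | std_normal_distribution. iexp (t * (\<mu> + sqrt v * x)))"
    unfolding gaussian_real_eq_distr [OF assms] char_def by (subst integral_distr) auto
  also have "\<dots> = (CLINT x | std_normal_distribution. iexp (t * \<mu>) * iexp ((t * sqrt v) * x))"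
    by (intro Bochner_Integration.integral_cong refl)
      (simp add: exp_add [symmetric] algebra_simps)
  also have "\<dots> = iexp (t * \<mu>) * char std_normal_distribution (t * sqrt v)"
    unfolding char_def by (rule integral_mult_right_zero)
  also have "\<dots> = exp (\<i> * of_real (t * \<mu>) - of_real (v * t\<^sup>2 / 2))"
    using assms
    by (simp only: char_std_normal_distribution exp_of_real [symmetric] exp_add [symmetric])
      (simp add: power_mult_distrib mult.commute)
  finally show ?thesis .
qed

lemma borel_measurable_matrix_vector_mult:
  fixes T :: "real^'n^'m"
  shows "(\<lambda>x. T *v x) \<in> borel_measurable borel"
  by (intro borel_measurable_continuous_onI matrix_vector_mult_linear_continuous_on)

text \<open>The projection of \<open>T *v X w + c\<close> along \<open>a\<close> is the projection
  of \<open>X w\<close> along \<open>transpose T *v a\<close>, shifted by a constant.\<close>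

lemma gaussian_vec_affine:
  fixes T :: "real^'n^'m"
  assumes X: "gaussian_vec M X \<mu> S"
  shows "gaussian_vec M (\<lambda>w. T *v X w + c) (T *v \<mu> + c) (T ** S ** transpose T)"
  unfolding gaussian_vec_def
proof (intro conjI allI)
  have X_meas [measurable]: "X \<in> borel_measurable M" and S: "sym_psd S"
    and d: "\<And>a. distr M borel (\<lambda>w. a \<bullet> X w) = gaussian_real (a \<bullet> \<mu>) (a \<bullet> (S *v a))"
    using X by (auto simp: gaussian_vec_def)
  have [measurable]: "(\<lambda>w. T *v X w) \<in> borel_measurable M"
    using borel_measurable_matrix_vector_mult X_meas by (rule measurable_compose_rev)
  show "(\<lambda>w. T *v X w + c) \<in> borel_measurable M" by measurable
  show "sym_psd (T ** S ** transpose T)" using S by (rule sym_psd_congruence)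
  fix a
  let ?b = "transpose T *v a"
  have v: "0 \<le> ?b \<bullet> (S *v ?b)" using S by (simp add: sym_psd_def)
  have "distr M borel (\<lambda>w. a \<bullet> (T *v X w + c)) = distr (distr M borel (\<lambda>w. ?b \<bullet> X w)) borel (\<lambda>x. x + a \<bullet> c)"
    by (simp add: distr_distr comp_def inner_add_right inner_matrix_vector_mult_right)
  also have "\<dots> = gaussian_real (?b \<bullet> \<mu> + a \<bullet> c) (?b \<bullet> (S *v ?b))"
    unfolding d gaussian_real_eq_distr [OF v]
    by (simp add: distr_distr comp_def algebra_simps)
  finally show "distr M borel (\<lambda>w. a \<bullet> (T *v X w + c))
      = gaussian_real (a \<bullet> (T *v \<mu> + c)) (a \<bullet> ((T ** S ** transpose T) *v a))"
    by (simp only: quadratic_form_congruence inner_add_right inner_matrix_vector_mult_right [of a T \<mu>])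
qed

lemma gaussian_vec_linear:
  fixes T :: "real^'n^'m"
  assumes "gaussian_vec M X \<mu> S"
  shows "gaussian_vec M (\<lambda>w. T *v X w) (T *v \<mu>) (T ** S ** transpose T)"
  using gaussian_vec_affine [OF assms, of T 0] by simp

text \<open>The equations between random vectors are only known on \<open>space M\<close>; this
  allows them to be substituted all the same.\<close>

lemma gaussian_vec_cong:
  assumes "\<And>w. w \<in> space M \<Longrightarrow> X w = Y w"
  shows "gaussian_vec M X \<mu> S \<longleftrightarrow> gaussian_vec M Y \<mu> S"
proof -
  have "distr M borel (\<lambda>w. a \<bullet> X w) = distr M borel (\<lambda>w. a \<bullet> Y w)" for a
    by (rule distr_cong) (use assms in auto)
  then show ?thesis
    unfolding gaussian_vec_def using measurable_cong [of M X Y borel] assms by auto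
qed

text \<open>Each projection is a sum of independent real Gaussian variables: characteristic
  functions multiply, so the exponents, and with them means and variances, add up. No density
  enters, so any \<open>S i\<close> may be singular.\<close>

lemma (in prob_space) gaussian_vec_sum:
  fixes W :: "'i \<Rightarrow> 'a \<Rightarrow> real^'d"
  assumes indep: "indep_vars (\<lambda>_. borel) W I"
    and W: "\<And>i. i \<in> I \<Longrightarrow> gaussian_vec M (W i) (\<mu> i) (S i)"
    and "finite I"
  shows "gaussian_vec M (\<lambda>w. \<Sum>i\<in>I. W i w) (\<Sum>i\<in>I. \<mu> i) (\<Sum>i\<in>I. S i)"
  unfolding gaussian_vec_def
proof (intro conjI allI)
  have meas: "W i \<in> borel_measurable M" and psd: "sym_psd (S i)"
    and d: "\<And>a. distr M borel (\<lambda>w. a \<bullet> W i w) = gaussian_real (a \<bullet> \<mu> i) (a \<bullet> (S i *v a))"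
    if "i \<in> I" for i
    using W [OF that] by (auto simp: gaussian_vec_def)
  show sum_meas: "(\<lambda>w. \<Sum>i\<in>I. W i w) \<in> borel_measurable M"
    by (rule borel_measurable_sum) (rule meas)
  show sum_psd: "sym_psd (\<Sum>i\<in>I. S i)"
    by (rule sym_psd_sum) (rule psd)
  fix a
  let ?m = "a \<bullet> (\<Sum>i\<in>I. \<mu> i)" and ?v = "a \<bullet> ((\<Sum>i\<in>I. S i) *v a)"
  have indep_a: "indep_vars (\<lambda>_. borel) (\<lambda>i w. a \<bullet> W i w) I"
    by (rule indep_vars_compose2 [OF indep]) measurable
  have m: "?m = (\<Sum>i\<in>I. a \<bullet> \<mu> i)" by (simp add: inner_sum_right)
  have v: "?v = (\<Sum>i\<in>I. a \<bullet> (S i *v a))"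
    by (simp add: sum_matrix_vector_mult inner_sum_right)
  have v_nonneg: "0 \<le> ?v" using sum_psd by (simp add: sym_psd_def)
  show "distr M borel (\<lambda>w. a \<bullet> (\<Sum>i\<in>I. W i w)) = gaussian_real ?m ?v"
  proof (rule Levy_uniqueness)
    show "real_distribution (distr M borel (\<lambda>w. a \<bullet> (\<Sum>i\<in>I. W i w)))"
      by (intro real_distribution_distr borel_measurable_inner borel_measurable_const sum_meas)
    show "real_distribution (gaussian_real ?m ?v)"
      by (rule real_distribution_gaussian_real [OF v_nonneg])
    show "char (distr M borel (\<lambda>w. a \<bullet> (\<Sum>i\<in>I. W i w))) = char (gaussian_real ?m ?v)"
    proof
      fix t
      have "char (distr M borel (\<lambda>w. a \<bullet> (\<Sum>i\<in>I. W i w))) t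
          = (\<Prod>i\<in>I. char (gaussian_real (a \<bullet> \<mu> i) (a \<bullet> (S i *v a))) t)"
        using char_distr_sum [OF indep_a, of t] d by (simp add: inner_sum_right)
      also have "\<dots> = (\<Prod>i\<in>I. exp (\<i> * of_real (t * (a \<bullet> \<mu> i)) - of_real ((a \<bullet> (S i *v a)) * t\<^sup>2 / 2)))"
        by (intro prod.cong refl char_gaussian_real) (use psd in \<open>auto simp: sym_psd_def\<close>)
      also have "\<dots> = exp (\<i> * of_real (t * ?m) - of_real (?v * t\<^sup>2 / 2))"
        unfolding m v exp_sum [OF \<open>finite I\<close>, symmetric]
        by (simp add: sum_subtractf sum_distrib_left sum_distrib_right sum_divide_distrib)
      also have "\<dots> = char (gaussian_real ?m ?v) t"
        by (rule char_gaussian_real [OF v_nonneg, symmetric])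
      finally show "char (distr M borel (\<lambda>w. a \<bullet> (\<Sum>i\<in>I. W i w))) t = char (gaussian_real ?m ?v) t" .
    qed
  qed
qed

section \<open>Decay of matrix powers\<close>

lemma contractive_recursion_tendsto_0:
  fixes h b :: "nat \<Rightarrow> real"
  assumes nonneg: "\<And>k. 0 \<le> h k" and q: "0 \<le> q" "q < 1"
    and step: "\<And>k. h (Suc k) \<le> q * h k + b k" and b: "b \<longlonglongrightarrow> 0"
  shows "h \<longlonglongrightarrow> 0"
proof (rule LIMSEQ_I)
  fix \<epsilon> :: real
  assume "0 < \<epsilon>"
  \<comment> \<open>Chosen so that \<open>\<epsilon> / 2\<close> is the fixed point of
    \<open>t \<mapsto> q * t + \<delta>\<close>; the part of \<open>h\<close> above it then shrinks
    by \<open>q\<close> in every step.\<close>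
  define \<delta> where "\<delta> = \<epsilon> / 2 * (1 - q)"
  have "0 < \<delta>" using \<open>0 < \<epsilon>\<close> q by (simp add: \<delta>_def)
  from LIMSEQ_D [OF b this] obtain K where K: "\<And>k. K \<le> k \<Longrightarrow> \<bar>b k\<bar> < \<delta>"
    by auto
  have bound: "h (K + m) \<le> q ^ m * h K + \<epsilon> / 2" for m
  proof (induction m)
    case 0
    then show ?case using \<open>0 < \<epsilon>\<close> by simp
  next
    case (Suc m)
    have "h (K + Suc m) \<le> q * h (K + m) + b (K + m)"
      using step [of "K + m"] by simp
    also have "\<dots> \<le> q * (q ^ m * h K + \<epsilon> / 2) + \<delta>"
      using K [of "K + m"] Suc q(1) by (intro add_mono mult_left_mono) auto
    also have "\<dots> = q ^ Suc m * h K + \<epsilon> / 2"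
      by (simp add: \<delta>_def field_simps)
    finally show ?case .
  qed
  have "(\<lambda>m. q ^ m * h K) \<longlonglongrightarrow> 0"
    using LIMSEQ_power_zero [of q] q by (intro tendsto_mult_left_zero) simp
  from LIMSEQ_D [OF this, of "\<epsilon> / 2"] \<open>0 < \<epsilon>\<close>
  obtain m0 where m0: "\<And>m. m0 \<le> m \<Longrightarrow> \<bar>q ^ m * h K\<bar> < \<epsilon> / 2"
    by auto
  have "norm (h k - 0) < \<epsilon>" if "K + m0 \<le> k" for k
    proof -
    have "m0 \<le> k - K" "K + (k - K) = k" using that by auto
    then show ?thesis
      using bound [of "k - K"] m0 [of "k - K"] nonneg [of k] by auto
  qed
  then show "\<exists>k0. \<forall>k\<ge>k0. norm (h k - 0) < \<epsilon>" by blast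
qed

text \<open>One more vector than the dimension forces a linear dependence. Its coefficients are
  stored in a polynomial, so that for the powers of a matrix the relation can later be
  factored.\<close>

lemma linear_relation_in_sequence:
  fixes f :: "nat \<Rightarrow> 'a::euclidean_space"
  shows "\<exists>p::real poly. p \<noteq> 0 \<and> (\<Sum>i\<le>degree p. coeff p i *\<^sub>R f i) = 0"
proof -
  define N where "N = DIM('a)"
  obtain c :: "nat \<Rightarrow> real" where c: "\<exists>i\<le>N. c i \<noteq> 0" "(\<Sum>i\<le>N. c i *\<^sub>R f i) = 0"
  proof (cases "inj_on f {..N}")
    case True
    then have "card (f ` {..N}) = Suc N" by (simp add: card_image)
    then have "dependent (f ` {..N})"
      using independent_bound [of "f ` {..N}"] by (auto simp: N_def)
    then obtain u where u: "\<exists>v\<in>f ` {..N}. u v \<noteq> 0" "(\<Sum>v\<in>f ` {..N}. u v *\<^sub>R v) = 0"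
      by (auto simp: dependent_finite)
    show ?thesis
      using that [of "\<lambda>i. u (f i)"] u by (auto simp: sum.reindex [OF True])
  next
    case False
    then obtain i j where ij: "i \<le> N" "j \<le> N" "i \<noteq> j" "f i = f j"
      by (auto simp: inj_on_def)
    show ?thesis
    \<comment> \<open>Linear dependence concerns sets and does not see repetitions, so two equal
      terms are handled by the relation \<open>f i - f j = 0\<close>.\<close>
    proof (rule that [of "\<lambda>k. of_bool (k = i) - of_bool (k = j)"])
      show "\<exists>k\<le>N. of_bool (k = i) - of_bool (k = j) \<noteq> (0::real)"
        using ij by (intro exI [of _ i]) auto
      have "(\<Sum>k\<le>N. (of_bool (k = i) - of_bool (k = j)) *\<^sub>R f k)
          = (\<Sum>k\<le>N. if k = i then f k else 0) - (\<Sum>k\<le>N. if k = j then f k else 0)"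
        unfolding sum_subtractf [symmetric] by (intro sum.cong) auto
      then show "(\<Sum>k\<le>N. (of_bool (k = i) - of_bool (k = j)) *\<^sub>R f k) = 0"
        using ij by simp
    qed
  qed
  define p where "p = Poly (map c [0..<Suc N])"
  have coeff_p: "coeff p i = (if i \<le> N then c i else 0)" for i
    by (auto simp: p_def coeff_Poly_eq nth_default_def nth_append less_Suc_eq_le simp del: upt_Suc)
  have "p \<noteq> 0"
    using c(1) coeff_p by (metis coeff_0)
  moreover have "degree p \<le> N"
    by (rule degree_le) (simp add: coeff_p)
  then have "(\<Sum>i\<le>degree p. coeff p i *\<^sub>R f i) = (\<Sum>i\<le>N. coeff p i *\<^sub>R f i)"
    by (intro sum.mono_neutral_left) (auto simp: coeff_eq_0)
  ultimately show ?thesis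
    using c(2) by (auto simp: coeff_p)
qed

text \<open>A polynomial acts on sequences through the shift, and products of polynomials act by
  composition. The factor with root \<open>c\<close> turns \<open>x\<close> into the sequence
  \<open>x (Suc k) - c *s x k\<close>, to which \<open>q\<close> is then applied.\<close>

lemma shift_polynomial_factor:
  fixes x :: "nat \<Rightarrow> complex^'n" and q :: "complex poly"
  assumes "q \<noteq> 0"
  shows "(\<Sum>i\<le>degree ([:- c, 1:] * q). coeff ([:- c, 1:] * q) i *s x (k + i))
    = (\<Sum>i\<le>degree q. coeff q i *s (x (Suc (k + i)) - c *s x (k + i)))"
proof -
  let ?d = "degree q"
  have deg: "degree ([:- c, 1:] * q) = Suc ?d"
    using assms by (subst degree_mult_eq) auto
  have coeff: "coeff ([:- c, 1:] * q) i = (case i of 0 \<Rightarrow> 0 | Suc j \<Rightarrow> coeff q j) - c * coeff q i" for i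
    by (simp add: coeff_pCons split: nat.split)
  have "(\<Sum>i\<le>Suc ?d. coeff ([:- c, 1:] * q) i *s x (k + i))
      = (\<Sum>i\<le>Suc ?d. (case i of 0 \<Rightarrow> 0 | Suc j \<Rightarrow> coeff q j) *s x (k + i))
        - (\<Sum>i\<le>Suc ?d. (c * coeff q i) *s x (k + i))"
    unfolding coeff by (simp only: vector_sub_rdistrib sum_subtractf)
  also have "(\<Sum>i\<le>Suc ?d. (case i of 0 \<Rightarrow> 0 | Suc j \<Rightarrow> coeff q j) *s x (k + i))
      = (\<Sum>i\<le>?d. coeff q i *s x (Suc (k + i)))"
    by (subst sum.atMost_Suc_shift) simp
  \<comment> \<open>The summand at \<open>Suc ?d\<close> lies beyond the degree of \<open>q\<close>
    and vanishes.\<close>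
  also have "(\<Sum>i\<le>Suc ?d. (c * coeff q i) *s x (k + i)) = (\<Sum>i\<le>?d. coeff q i *s (c *s x (k + i)))"
    by (simp add: coeff_eq_0 mult.commute)
  finally show ?thesis
    unfolding deg by (simp add: sum_subtractf [symmetric] vector_ssub_ldistrib)
qed

lemma tendsto_matrix_vector_mult_zero:
  fixes B :: "complex^'n^'m"
  assumes "u \<longlonglongrightarrow> 0"
  shows "(\<lambda>k. B *v u k) \<longlonglongrightarrow> 0"
proof (rule vec_tendstoI)
  fix i
  have "(\<lambda>k. \<Sum>j\<in>UNIV. B $ i $ j * u k $ j) \<longlonglongrightarrow> (\<Sum>j\<in>UNIV. B $ i $ j * (0::complex^'n) $ j)"
    by (intro tendsto_intros assms)
  then show "(\<lambda>k. (B *v u k) $ i) \<longlonglongrightarrow> (0::complex^'m) $ i"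
    by (simp add: matrix_vector_mult_def)
qed

text \<open>The hypothesis says that \<open>q\<close> applied to the shift maps the orbit to a null sequence. Split off a
  linear factor \<open>z - c\<close>: by induction \<open>(A - c) x\<^sub>k \<longlongrightarrow> 0\<close>. If \<open>c\<close> is an eigenvalue, then \<open>x\<close> solves a
  contractive scalar recursion with vanishing input; otherwise \<open>A - c\<close> is invertible.\<close>

lemma orbit_tendsto_0_of_polynomial:
  fixes A :: "complex^'n^'n" and q :: "complex poly" and x :: "nat \<Rightarrow> complex^'n"
  assumes eig: "\<And>c v. v \<noteq> 0 \<Longrightarrow> A *v v = c *s v \<Longrightarrow> cmod c < 1"
    and "q \<noteq> 0" and "\<And>k. x (Suc k) = A *v x k"
    and "(\<lambda>k. \<Sum>i\<le>degree q. coeff q i *s x (k + i)) \<longlonglongrightarrow> 0"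
  shows "x \<longlonglongrightarrow> 0"
  using assms(2-)
proof (induction "degree q" arbitrary: q x)
  case 0
  then have d: "degree q = 0" and c: "coeff q 0 \<noteq> 0"
    using leading_coeff_0_iff [of q] by auto
  show ?case
  proof (rule vec_tendstoI)
    fix i
    have "(\<lambda>k. (coeff q 0 *s x k) $ i) \<longlonglongrightarrow> (0::complex^'n) $ i"
      using 0(4) by (intro tendsto_vec_nth) (simp add: d)
    then have "(\<lambda>k. inverse (coeff q 0) * (coeff q 0 * x k $ i)) \<longlonglongrightarrow> inverse (coeff q 0) * 0"
      by (intro tendsto_mult_left) simp
    then show "(\<lambda>k. x k $ i) \<longlonglongrightarrow> (0::complex^'n) $ i"
      using c by (simp add: mult.assoc [symmetric])
  qed
next
  case (Suc d)
  have "\<not> constant (poly q)"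
    using Suc.hyps(2) by (simp add: constant_degree)
  then obtain c where "poly q c = 0"
    using fundamental_theorem_of_algebra by blast
  then obtain q' where q': "q = [:- c, 1:] * q'"
    by (auto simp: poly_eq_0_iff_dvd elim: dvdE)
  then have "q' \<noteq> 0" using \<open>q \<noteq> 0\<close> by auto
  then have "degree q = Suc (degree q')"
    unfolding q' by (subst degree_mult_eq) auto
  then have d: "d = degree q'" using Suc.hyps(2) by simp
  \<comment> \<open>\<open>u k\<close> is \<open>(A - c)\<close> applied to \<open>x k\<close>. As
    \<open>A\<close> commutes with \<open>A - c\<close>, this is again an orbit of \<open>A\<close>,
    and the factorisation turns the hypothesis on \<open>q\<close> and \<open>x\<close> into the one
    on \<open>q'\<close> and \<open>u\<close>.\<close>
  define u where "u k = x (Suc k) - c *s x k" for k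
  have u: "u \<longlonglongrightarrow> 0"
  proof (rule Suc.hyps(1) [OF d \<open>q' \<noteq> 0\<close>])
    show "u (Suc k) = A *v u k" for k
      by (simp add: u_def Suc.prems(2) matrix_vector_mult_diff_distrib vector_scalar_commute)
    show "(\<lambda>k. \<Sum>i\<le>degree q'. coeff q' i *s u (k + i)) \<longlonglongrightarrow> 0"
      using Suc.prems(3) unfolding q' shift_polynomial_factor [OF \<open>q' \<noteq> 0\<close>] u_def .
  qed
  show ?case
  proof (cases "\<exists>v. v \<noteq> 0 \<and> A *v v = c *s v")
    case True
    then have "cmod c < 1" using eig by blast
    show ?thesis
    proof (rule vec_tendstoI)
      fix i
      have "(\<lambda>k. cmod (x k $ i)) \<longlonglongrightarrow> 0"
      proof (rule contractive_recursion_tendsto_0)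
        show "cmod (x (Suc k) $ i) \<le> cmod c * cmod (x k $ i) + cmod (u k $ i)" for k
          using norm_triangle_ineq [of "c * x k $ i" "u k $ i"] by (simp add: u_def norm_mult)
        have "(\<lambda>k. cmod (u k $ i)) \<longlonglongrightarrow> cmod ((0::complex^'n) $ i)"
          using u by (intro tendsto_norm tendsto_vec_nth)
        then show "(\<lambda>k. cmod (u k $ i)) \<longlonglongrightarrow> 0" by simp
      qed (use \<open>cmod c < 1\<close> in auto)
      then show "(\<lambda>k. x k $ i) \<longlonglongrightarrow> (0::complex^'n) $ i"
        by (simp add: tendsto_norm_zero_iff)
    qed
  next
    case False
    have scalar: "mat c *v v = c *s v" for v :: "complex^'n"
      by (simp add: vec_eq_iff matrix_vector_mult_def mat_def if_distrib if_distribR cong: if_cong)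
    have "v = 0" if "(A - mat c) *v v = 0" for v
      using False that by (auto simp: matrix_vector_mult_diff_rdistrib scalar)
    then obtain B where B: "B ** (A - mat c) = mat 1"
      using matrix_left_invertible_ker by blast
    have "x k = B *v u k" for k
    proof -
      have "u k = (A - mat c) *v x k"
        by (simp add: u_def Suc.prems(2) matrix_vector_mult_diff_rdistrib scalar)
      then show ?thesis by (simp add: matrix_vector_mul_assoc B)
    qed
    then show ?thesis
      using tendsto_matrix_vector_mult_zero [OF u, of B] by presburger
  qed
qed

section \<open>Complexified real matrices, in the entrywise form that occurs inside
  \<open>spec_radius\<close>\<close>

definition complex_mat :: "real^'n^'m \<Rightarrow> complex^'n^'m" where
  "complex_mat A = (\<chi> i j. complex_of_real (A $ i $ j))"

lemma complex_mat_mult: "complex_mat (A ** B) = complex_mat A ** complex_mat B"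
  by (simp add: complex_mat_def matrix_matrix_mult_def vec_eq_iff)

lemma complex_mat_mat_1: "complex_mat (mat 1) = mat 1"
  by (simp add: complex_mat_def mat_def vec_eq_iff)

lemma complex_mat_relation:
  fixes f :: "'i \<Rightarrow> real^'n^'m"
  assumes "(\<Sum>i\<in>I. c i *\<^sub>R f i) = 0"
  shows "(\<Sum>i\<in>I. complex_of_real (c i) *s (complex_mat (f i) *v v)) = 0"
proof -
  have "(\<Sum>i\<in>I. complex_of_real (c i) *s (complex_mat (f i) *v v)) = complex_mat (\<Sum>i\<in>I. c i *\<^sub>R f i) *v v"
    by (induction I rule: infinite_finite_induct)
      (simp_all add: complex_mat_def vec_eq_iff matrix_vector_mult_def sum.distrib sum_distrib_left
        algebra_simps)
  then show ?thesis
    unfolding assms by (simp add: complex_mat_def vec_eq_iff matrix_vector_mult_def)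
qed

text \<open>The powers of \<open>F\<close> lie in a finite-dimensional space, which gives an
  annihilating polynomial. It is moved to complex coefficients, where it has roots.\<close>

lemma complex_matpow_relation:
  fixes F :: "real^'n^'n"
  obtains q :: "complex poly" where "q \<noteq> 0"
    "\<And>v. (\<Sum>i\<le>degree q. coeff q i *s (complex_mat (matpow F i) *v v)) = 0"
proof -
  obtain p where p: "p \<noteq> 0" "(\<Sum>i\<le>degree p. coeff p i *\<^sub>R matpow F i) = 0"
    using linear_relation_in_sequence [of "matpow F"] by blast
  let ?q = "map_poly complex_of_real p"
  show ?thesis
  proof (rule that)
    show "?q \<noteq> 0" using p(1) by (simp add: map_poly_eq_0_iff)
    show "(\<Sum>i\<le>degree ?q. coeff ?q i *s (complex_mat (matpow F i) *v v)) = 0" for v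
      using complex_mat_relation [OF p(2)] by (simp add: degree_map_poly coeff_map_poly)
  qed
qed

lemma matpow_add: "matpow F (i + j) = matpow F i ** matpow F j"
  by (induction i) (simp_all add: matrix_mul_assoc)

text \<open>Column \<open>j\<close> of the powers is the orbit of \<open>axis j 1\<close> under
  \<open>F\<close>. The annihilating polynomial makes the input of the orbit lemma identically
  zero.\<close>

lemma matpow_tendsto_0:
  fixes F :: "real^'n^'n"
  assumes eig: "\<And>c v. v \<noteq> 0 \<Longrightarrow> complex_mat F *v v = c *s v \<Longrightarrow> cmod c < 1"
  shows "matpow F \<longlonglongrightarrow> 0"
proof (intro vec_tendstoI)
  fix i j
  obtain q :: "complex poly" where q: "q \<noteq> 0"
    "\<And>v. (\<Sum>i\<le>degree q. coeff q i *s (complex_mat (matpow F i) *v v)) = 0"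
    using complex_matpow_relation [of F] by blast
  define x where "x k = complex_mat (matpow F k) *v axis j 1" for k
  have "x \<longlonglongrightarrow> 0"
  proof (rule orbit_tendsto_0_of_polynomial [OF eig \<open>q \<noteq> 0\<close>])
    show "x (Suc k) = complex_mat F *v x k" for k
      by (simp add: x_def complex_mat_mult matrix_vector_mul_assoc)
    \<comment> \<open>The relation is applied to the vector \<open>x k\<close>, which the
      \<open>i\<close>-th power of \<open>F\<close> sends to \<open>x (k + i)\<close>.\<close>
    have "(\<Sum>i\<le>degree q. coeff q i *s x (k + i)) = 0" for k
      using q(2) [of "x k"]
      by (simp add: x_def matrix_vector_mul_assoc complex_mat_mult [symmetric] matpow_add [symmetric]
          add.commute)
    then show "(\<lambda>k. \<Sum>i\<le>degree q. coeff q i *s x (k + i)) \<longlonglongrightarrow> 0" by simp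
  qed
  then have "(\<lambda>k. x k $ i) \<longlonglongrightarrow> (0::complex^'n) $ i"
    by (rule tendsto_vec_nth)
  moreover have "x k $ i = complex_of_real (matpow F k $ i $ j)" for k
    by (simp add: x_def matrix_vector_mult_def axis_def complex_mat_def if_distrib cong: if_cong)
  ultimately have "(\<lambda>k. complex_of_real (matpow F k $ i $ j)) \<longlonglongrightarrow> complex_of_real 0"
    by simp
  then show "(\<lambda>k. matpow F k $ i $ j) \<longlonglongrightarrow> (0::real^'n^'n) $ i $ j"
    unfolding tendsto_of_real_iff by simp
qed

text \<open>\<open>Max\<close> is an upper bound only for finite sets. The spectrum is finite
  because every eigenvalue is a root of the annihilating polynomial.\<close>

lemma cmod_eigenvalue_le_spec_radius:
  fixes F :: "real^'n^'n"
  assumes "v \<noteq> 0" "complex_mat F *v v = c *s v"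
  shows "cmod c \<le> spec_radius F"
proof -
  define E where "E = {c. \<exists>v::complex^'n. v \<noteq> 0 \<and> complex_mat F *v v = c *s v}"
  obtain q :: "complex poly" where q: "q \<noteq> 0"
    "\<And>v. (\<Sum>i\<le>degree q. coeff q i *s (complex_mat (matpow F i) *v v)) = 0"
    using complex_matpow_relation [of F] by blast
  have "poly q c = 0" if v: "v \<noteq> 0" "complex_mat F *v v = c *s v" for c and v :: "complex^'n"
  proof -
    have pow: "complex_mat (matpow F i) *v v = c ^ i *s v" for i
      by (induction i)
        (simp_all add: complex_mat_mat_1 complex_mat_mult matrix_vector_mul_assoc [symmetric]
          vector_scalar_commute v mult.commute)
    have "(\<Sum>i\<le>degree q. (coeff q i * c ^ i) *s v) = 0"
      using q(2) [of v] by (simp add: pow)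
    then have "poly q c *s v = 0"
      by (simp add: poly_altdef vec.scale_sum_left)
    then show ?thesis using v(1) by simp
  qed
  then have "E \<subseteq> {c. poly q c = 0}" by (auto simp: E_def)
  then have "finite E"
    using poly_roots_finite [OF \<open>q \<noteq> 0\<close>] by (rule finite_subset)
  moreover have "spec_radius F = Max (cmod ` E)"
    by (simp add: spec_radius_def E_def complex_mat_def)
  ultimately show ?thesis
    using assms by (auto simp: E_def intro!: Max_ge)
qed

lemma matpow_scaleR: "matpow (a *\<^sub>R F) k = a ^ k *\<^sub>R matpow F k"
  by (induction k) (simp_all add: scalar_matrix_assoc [symmetric] matrix_scalar_ac mult.commute)

lemma matpow_geometric_decay:
  fixes F :: "real^'n^'n"
  assumes "spec_radius F < 1"
  obtains r where "0 < r" "r < 1" "(\<lambda>k. (1 / r) ^ k *\<^sub>R matpow F k) \<longlonglongrightarrow> 0"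
proof -
  \<comment> \<open>The midpoint between the spectral radius, replaced by \<open>0\<close> if
    negative, and \<open>1\<close>. Dividing \<open>F\<close> by \<open>r\<close> keeps all
    eigenvalues inside the open unit disc.\<close>
  define r where "r = (max 0 (spec_radius F) + 1) / 2"
  have r: "0 < r" "r < 1" "spec_radius F < r"
    using assms by (auto simp: r_def max_def field_simps)
  have "matpow ((1 / r) *\<^sub>R F) \<longlonglongrightarrow> 0"
  proof (rule matpow_tendsto_0)
    fix c and v :: "complex^'n"
    assume v: "v \<noteq> 0" "complex_mat ((1 / r) *\<^sub>R F) *v v = c *s v"
    have "complex_mat F *v v = of_real r *s (complex_mat ((1 / r) *\<^sub>R F) *v v)"
      using r by (simp add: complex_mat_def vec_eq_iff matrix_vector_mult_def sum_distrib_left)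
    then have "complex_mat F *v v = (of_real r * c) *s v"
      by (simp add: v)
    then have "cmod (of_real r * c) \<le> spec_radius F"
      by (rule cmod_eigenvalue_le_spec_radius [OF v(1)])
    then have "cmod c * r \<le> spec_radius F" using r by (simp add: norm_mult mult.commute)
    then have "cmod c * r < 1 * r" using r by linarith
    then show "cmod c < 1" using r(1) mult_less_cancel_right_pos by blast
  qed
  then have "(\<lambda>k. (1 / r) ^ k *\<^sub>R matpow F k) \<longlonglongrightarrow> 0"
    unfolding matpow_scaleR .
  then show ?thesis
    using r(1,2) that by blast
qed

section \<open>The Lyapunov equation\<close>

lemma bounded_bilinear_matrix_mult:
  "bounded_bilinear ((**) :: real^'n^'m \<Rightarrow> real^'k^'n \<Rightarrow> real^'k^'m)"
  unfolding bilinear_conv_bounded_bilinear [symmetric] bilinear_def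
  by (auto intro!: linearI
      simp: matrix_matrix_mult_def vec_eq_iff sum.distrib sum_distrib_left algebra_simps)

interpretation matrix_mult: bounded_bilinear
  "(**) :: real^'n^'m \<Rightarrow> real^'k^'n \<Rightarrow> real^'k^'m"
  by (rule bounded_bilinear_matrix_mult)

lemma matpow_Suc_right: "matpow F (Suc k) = matpow F k ** F"
  using matpow_add [of F k 1] by simp

lemma transpose_matpow: "transpose (matpow F k) = matpow (transpose F) k"
proof (induction k)
  case (Suc k)
  then show ?case
    by (simp only: matpow_Suc_right [of F] matrix_transpose_mul matpow.simps(2) [of "transpose F"])
qed (simp add: transpose_mat)

text \<open>Every old summand gains one factor \<open>F\<close> on the left and one
  \<open>transpose F\<close> on the right; the new summand \<open>k = j\<close> has exponent
  \<open>0\<close> and is just \<open>Q j\<close>.\<close>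

lemma lyapunov_recursion_sum:
  fixes F P0 :: "real^'n^'n" and P Q :: "nat \<Rightarrow> real^'n^'n"
  assumes P: "\<And>j. P j = matpow F j ** P0 ** matpow (transpose F) j
      + (\<Sum>k<j. matpow F (j - 1 - k) ** Q k ** matpow (transpose F) (j - 1 - k))"
  shows "P (Suc j) = F ** P j ** transpose F + Q j"
proof -
  let ?T = "transpose F"
  have step: "matpow F (Suc i) ** R ** matpow ?T (Suc i) = F ** (matpow F i ** R ** matpow ?T i) ** ?T" for i R
    by (simp only: matpow.simps(2) [of F] matpow_Suc_right [of ?T] matrix_mul_assoc)
  have "(\<Sum>k<j. matpow F (Suc j - 1 - k) ** Q k ** matpow ?T (Suc j - 1 - k))
      = (\<Sum>k<j. F ** (matpow F (j - 1 - k) ** Q k ** matpow ?T (j - 1 - k)) ** ?T)"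
  proof (rule sum.cong)
    fix k
    assume "k \<in> {..<j}"
    \<comment> \<open>Subtraction is truncated, so \<open>k < j\<close> matters here.\<close>
    then have "Suc j - 1 - k = Suc (j - 1 - k)" by auto
    then show "matpow F (Suc j - 1 - k) ** Q k ** matpow ?T (Suc j - 1 - k)
        = F ** (matpow F (j - 1 - k) ** Q k ** matpow ?T (j - 1 - k)) ** ?T"
      by (simp only: step)
  qed simp
  then show ?thesis
    unfolding P step
    by (simp add: matrix_mult.add_left matrix_mult.add_right matrix_mult.sum_left matrix_mult.sum_right)
qed

lemma geometric_bound_of_scaled_tendsto_0:
  fixes f :: "nat \<Rightarrow> 'a::real_normed_vector"
  assumes "0 < r" "(\<lambda>k. (1 / r) ^ k *\<^sub>R f k) \<longlonglongrightarrow> 0"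
  obtains c where "0 < c" "\<And>k. norm (f k) \<le> c * r ^ k"
proof -
  obtain c where c: "0 < c" "\<And>k. norm ((1 / r) ^ k *\<^sub>R f k) \<le> c"
    using convergent_imp_Bseq [OF convergentI, OF assms(2)] by (auto elim: BseqE)
  have "norm (f k) \<le> c * r ^ k" for k
    using c(2) [of k] assms(1) by (simp add: power_one_over field_simps)
  then show ?thesis using c(1) that by blast
qed

text \<open>The convolution of inputs and powers is not estimated directly. The norm of
  \<open>D j\<close> is instead dominated by a multiple of the scalar sequence \<open>h\<close>,
  which obeys a contractive recursion with input \<open>norm (E j)\<close>.\<close>

lemma stable_lyapunov_recursion_tendsto_0:
  fixes F :: "real^'n^'n" and D E :: "nat \<Rightarrow> real^'n^'n"
  assumes stable: "spec_radius F < 1"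
    and D: "\<And>j. D (Suc j) = F ** D j ** transpose F + E j"
    and E: "E \<longlonglongrightarrow> 0"
  shows "D \<longlonglongrightarrow> 0"
proof -
  let ?T = "transpose F"
  obtain r where r: "0 < r" "r < 1" and lim: "(\<lambda>k. (1 / r) ^ k *\<^sub>R matpow F k) \<longlonglongrightarrow> 0"
    using matpow_geometric_decay [OF stable] by blast
  have lim': "(\<lambda>k. (1 / r) ^ k *\<^sub>R matpow ?T k) \<longlonglongrightarrow> 0"
  proof (intro vec_tendstoI)
    fix a b
    have "(\<lambda>k. ((1 / r) ^ k *\<^sub>R matpow F k) $ b $ a) \<longlonglongrightarrow> (0::real^'n^'n) $ b $ a"
      by (intro tendsto_vec_nth lim)
    then show "(\<lambda>k. ((1 / r) ^ k *\<^sub>R matpow ?T k) $ a $ b) \<longlonglongrightarrow> (0::real^'n^'n) $ a $ b"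
      unfolding transpose_matpow [symmetric] by (simp add: transpose_def)
  qed
  obtain c where c: "0 < c" "\<And>k. norm (matpow F k) \<le> c * r ^ k"
    using geometric_bound_of_scaled_tendsto_0 [OF r(1) lim] by blast
  obtain c' where c': "0 < c'" "\<And>k. norm (matpow ?T k) \<le> c' * r ^ k"
    using geometric_bound_of_scaled_tendsto_0 [OF r(1) lim'] by blast
  \<comment> \<open>The matrix product is submultiplicative up to the constant that bounds it as a
    bilinear map.\<close>
  obtain B where B: "0 < B" "\<And>(P :: real^'n^'n) (Q :: real^'n^'n). norm (P ** Q) \<le> norm P * norm Q * B"
    using matrix_mult.pos_bounded by blast
  define \<kappa> where "\<kappa> = c * B * c' * B"
  have "0 \<le> \<kappa>" using c c' B by (simp add: \<kappa>_def)
  have sandwich: "norm (matpow F i ** P ** matpow ?T i) \<le> \<kappa> * r ^ i * norm P" for i P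
  proof -
    have "norm (matpow F i ** P ** matpow ?T i) \<le> norm (matpow F i ** P) * norm (matpow ?T i) * B"
      by (rule B)
    also have "\<dots> \<le> (norm (matpow F i) * norm P * B) * norm (matpow ?T i) * B"
      by (intro mult_right_mono B) (use B in auto)
    \<comment> \<open>One decaying factor suffices: the power of \<open>transpose F\<close> is only
      bounded by \<open>c'\<close>.\<close>
    also have "\<dots> \<le> ((c * r ^ i) * norm P * B) * (c' * 1) * B"
    proof (intro mult_right_mono mult_mono)
      show "norm (matpow ?T i) \<le> c' * 1"
        using c'(2) [of i] c'(1) r power_le_one [of r i]
        by (meson less_imp_le mult_left_mono order_trans)
    qed (use c c' B r in auto)
    finally show ?thesis by (simp add: \<kappa>_def mult_ac)
  qed
  define h where "h = rec_nat (norm (D 0)) (\<lambda>j x. r * x + norm (E j))"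
  have h: "h 0 = norm (D 0)" "h (Suc j) = r * h j + norm (E j)" for j
    by (simp_all add: h_def)
  have "0 \<le> h j" for j
    using r by (induction j) (simp_all add: h)
  then have "h \<longlonglongrightarrow> 0"
    by (rule contractive_recursion_tendsto_0 [where q = r and b = "\<lambda>j. norm (E j)"])
      (use r E h in \<open>auto intro: tendsto_norm_zero\<close>)
  \<comment> \<open>The exponent \<open>i\<close> stays arbitrary because unrolling \<open>D\<close>
    by one step raises it by one. The result is used at \<open>i = 0\<close>.\<close>
  have bound: "norm (matpow F i ** D j ** matpow ?T i) \<le> \<kappa> * r ^ i * h j" for i j
  proof (induction j arbitrary: i)
    case 0
    then show ?case using sandwich by (simp add: h)
  next
    case (Suc j)
    have "matpow F i ** D (Suc j) ** matpow ?T i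
        = matpow F (Suc i) ** D j ** matpow ?T (Suc i) + matpow F i ** E j ** matpow ?T i"
      by (simp only: D matpow_Suc_right [of F] matpow.simps(2) [of ?T] matrix_mul_assoc
          matrix_mult.add_left matrix_mult.add_right)
    also have "norm \<dots> \<le> \<kappa> * r ^ Suc i * h j + \<kappa> * r ^ i * norm (E j)"
      by (intro norm_triangle_le add_mono Suc sandwich)
    also have "\<dots> = \<kappa> * r ^ i * h (Suc j)"
      by (simp add: h algebra_simps)
    finally show ?case .
  qed
  show ?thesis
  proof (rule Lim_null_comparison)
    show "\<forall>\<^sub>F j in sequentially. norm (D j) \<le> \<kappa> * h j"
      using bound [of 0] by simp
    show "(\<lambda>j. \<kappa> * h j) \<longlonglongrightarrow> 0"
      using \<open>h \<longlonglongrightarrow> 0\<close> by (rule tendsto_mult_right_zero)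
  qed
qed

text \<open>A solution of the homogeneous equation, read as a constant sequence, obeys the stable
  recursion with zero input and hence vanishes. An injective linear map of a finite-dimensional
  space into itself is bijective.\<close>

lemma lyapunov_unique_solution:
  fixes F :: "real^'n^'n"
  assumes stable: "spec_radius F < 1"
  shows "\<exists>!P. P = F ** P ** transpose F + Q"
proof -
  let ?f = "\<lambda>P. P - F ** P ** transpose F"
  have "linear ?f"
    by (auto intro!: linearI simp: matrix_mult.add_left matrix_mult.add_right matrix_mult.scaleR_left
        matrix_mult.scaleR_right algebra_simps)
  moreover have "inj ?f"
    unfolding linear_injective_0 [OF \<open>linear ?f\<close>]
  proof safe
    fix P
    assume "?f P = 0"
    then have "(\<lambda>_. P) \<longlonglongrightarrow> 0"
      using stable_lyapunov_recursion_tendsto_0 [OF stable, of "\<lambda>_. P" "\<lambda>_. 0"] by simp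
    then show "P = 0" by (simp add: LIMSEQ_const_iff)
  qed
  ultimately have "bij ?f"
    using linear_injective_imp_surjective by (auto simp: bij_def)
  then have "\<exists>!P. ?f P = Q"
    by (simp add: bij_iff)
  moreover have "?f P = Q \<longleftrightarrow> P = F ** P ** transpose F + Q" for P
    by (auto simp: algebra_simps)
  ultimately show ?thesis by simp
qed

section \<open>Gaussian vectors with a prescribed covariance\<close>

text \<open>Makes the solution of the Lyapunov equation a covariance matrix, as the limit of the
  covariances of the states.\<close>

lemma sym_psd_limit:
  fixes S :: "nat \<Rightarrow> real^'n^'n"
  assumes "S \<longlonglongrightarrow> T" "\<And>k. sym_psd (S k)"
  shows "sym_psd T"
  unfolding sym_psd_def
proof (intro conjI allI)
  have "T $ j $ i = T $ i $ j" for i j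
  proof (rule LIMSEQ_unique)
    show "(\<lambda>k. S k $ i $ j) \<longlonglongrightarrow> T $ i $ j" by (intro tendsto_vec_nth assms)
    have "S k $ i $ j = S k $ j $ i" for k
      using assms(2) [of k] by (auto simp: sym_psd_def transpose_def vec_eq_iff)
    then show "(\<lambda>k. S k $ i $ j) \<longlonglongrightarrow> T $ j $ i"
      using assms(1) by (simp add: tendsto_vec_nth)
  qed
  then show "transpose T = T" by (simp add: vec_eq_iff transpose_def)
  fix x
  have "(\<lambda>k. x \<bullet> (S k *v x)) \<longlonglongrightarrow> x \<bullet> (T *v x)"
    unfolding matrix_mult_dot by (intro tendsto_intros assms)
  then show "0 \<le> x \<bullet> (T *v x)"
    by (rule LIMSEQ_le_const) (use assms(2) in \<open>auto simp: sym_psd_def\<close>)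
qed

section \<open>Semidefinite matrices as sums of rank-one matrices\<close>

definition outer :: "real^'n \<Rightarrow> real^'n^'n" where
  "outer u = (\<chi> i j. u $ i * u $ j)"

lemma outer_nth [simp]: "outer u $ i $ j = u $ i * u $ j"
  by (simp add: outer_def)

lemma quadratic_form_outer: "x \<bullet> (outer u *v x) = (x \<bullet> u)\<^sup>2"
proof -
  have "outer u *v x = (u \<bullet> x) *\<^sub>R u"
    by (simp add: vec_eq_iff matrix_vector_mult_def inner_vec_def sum_distrib_left mult_ac)
  then show ?thesis by (simp add: power2_eq_square inner_commute)
qed

lemma sym_psd_outer: "sym_psd (outer u)"
  by (simp add: sym_psd_def quadratic_form_outer transpose_def vec_eq_iff mult.commute)

text \<open>This is the quadratic form at \<open>x + t *\<^sub>R axis i 1\<close>; by symmetry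
  \<open>S\<close> maps that basis vector to its row \<open>S $ i\<close>. Suitable choices of
  \<open>t\<close> give the facts needed for the elimination below.\<close>

lemma sym_psd_quadratic_shift:
  fixes S :: "real^'n^'n"
  assumes "sym_psd S"
  shows "0 \<le> x \<bullet> (S *v x) + 2 * t * (x \<bullet> S $ i) + t\<^sup>2 * S $ i $ i"
proof -
  have sym: "transpose S = S" using assms by (simp add: sym_psd_def)
  let ?e = "axis i 1 :: real^'n"
  have Se: "S *v ?e = S $ i"
    using arg_cong [OF sym, of "\<lambda>A. A $ i"]
    by (simp add: matrix_vector_mult_basis column_def transpose_def)
  have "?e \<bullet> (S *v x) = S $ i \<bullet> x"
    by (simp add: inner_axis' matrix_mult_dot)
  then have "(x + t *\<^sub>R ?e) \<bullet> (S *v (x + t *\<^sub>R ?e))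
      = x \<bullet> (S *v x) + 2 * t * (x \<bullet> S $ i) + t\<^sup>2 * S $ i $ i"
    by (simp add: matrix_vector_right_distrib matrix_vector_mult_scaleR Se inner_add_left inner_add_right
        inner_axis' inner_commute power2_eq_square algebra_simps)
  then show ?thesis
    using assms by (metis sym_psd_def)
qed

text \<open>With a zero diagonal entry the shifted form is affine in \<open>t\<close>, so
  nonnegativity forces its slope to vanish; for \<open>x = S $ i\<close> the slope is twice the
  squared norm of that row.\<close>

lemma sym_psd_zero_diagonal:
  fixes S :: "real^'n^'n"
  assumes "sym_psd S" "S $ i $ i = 0"
  shows "S $ i = 0"
proof (rule ccontr)
  assume "S $ i \<noteq> 0"
  let ?x = "S $ i"
  have "?x \<bullet> S $ i \<noteq> 0" using \<open>S $ i \<noteq> 0\<close> by simp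
  then show False
    \<comment> \<open>This \<open>t\<close> gives the form the value \<open>-1\<close>.\<close>
    using sym_psd_quadratic_shift [OF assms(1), of ?x "- (?x \<bullet> (S *v ?x) + 1) / (2 * (?x \<bullet> S $ i))" i]
      assms(2) by (simp add: field_simps)
qed

text \<open>Cholesky elimination by induction on a set \<open>J\<close> that contains all indices
  with nonzero diagonal entry. Each pivot is removed by subtracting one rank-one matrix; the
  remainder stays semidefinite and its diagonal vanishes outside the smaller set.\<close>

lemma sym_psd_sum_outer:
  fixes S :: "real^'n^'n"
  assumes "finite J" "sym_psd S" "\<And>i. i \<notin> J \<Longrightarrow> S $ i $ i = 0"
  shows "\<exists>v. S = (\<Sum>i\<in>J. outer (v i))"
  using assms
proof (induction J arbitrary: S)
  case empty
  then show ?case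
    using sym_psd_zero_diagonal [of S] by (simp add: vec_eq_iff)
next
  case (insert i J)
  show ?case
  proof (cases "S $ i $ i = 0")
    case True
    then have "S $ j $ j = 0" if "j \<notin> J" for j
      using insert.prems(2) [of j] that by (cases "j = i") auto
    then obtain v where v: "S = (\<Sum>j\<in>J. outer (v j))"
      using insert.IH [OF insert.prems(1)] by blast
    have "outer (0 :: real^'n) = 0" by (simp add: vec_eq_iff)
    moreover have "(\<Sum>j\<in>J. outer ((v(i := 0)) j)) = (\<Sum>j\<in>J. outer (v j))"
      using insert.hyps by (intro sum.cong) auto
    ultimately have "S = (\<Sum>j\<in>insert i J. outer ((v(i := 0)) j))"
      using insert.hyps v by simp
    then show ?thesis by blast
  next
    case False
    have "0 \<le> S $ i $ i"
      using sym_psd_quadratic_shift [OF insert.prems(1), of 0 1 i] by simp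
    with False have pos: "0 < S $ i $ i" by simp
    have sym: "S $ a $ b = S $ b $ a" for a b
      using insert.prems(1) by (auto simp: sym_psd_def transpose_def vec_eq_iff)
    \<comment> \<open>The pivot row, scaled so that \<open>outer u\<close> agrees with
      \<open>S\<close> in row \<open>i\<close>.\<close>
    define u where "u = (1 / sqrt (S $ i $ i)) *\<^sub>R S $ i"
    define S' where "S' = S - outer u"
    have S'_nth: "S' $ a $ b = S $ a $ b - S $ i $ a * S $ i $ b / S $ i $ i" for a b
      using pos by (simp add: S'_def u_def)
    have "sym_psd S'"
      unfolding sym_psd_def
    proof (intro conjI allI)
      show "transpose S' = S'"
        by (simp add: vec_eq_iff transpose_def S'_nth sym mult.commute)
      fix x
      have "x \<bullet> (S' *v x) = x \<bullet> (S *v x) - (x \<bullet> u)\<^sup>2"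
        by (simp add: S'_def matrix_vector_mult_diff_rdistrib inner_diff_right quadratic_form_outer)
      also have "(x \<bullet> u)\<^sup>2 = (x \<bullet> S $ i)\<^sup>2 / S $ i $ i"
        using pos by (simp add: u_def power_divide)
      \<comment> \<open>The minimising \<open>t\<close> turns the shifted form of \<open>S\<close>
        into the form of the Schur complement \<open>S'\<close>.\<close>
      finally show "0 \<le> x \<bullet> (S' *v x)"
        using sym_psd_quadratic_shift [OF insert.prems(1), of x "- (x \<bullet> S $ i) / S $ i $ i" i] pos
        by (simp add: power2_eq_square)
    qed
    moreover have "S' $ j $ j = 0" if "j \<notin> J" for j
    proof (cases "j = i")
      case True
      then show ?thesis using pos by (simp add: S'_nth)
    next
      case False
      with that insert.prems(2) have "S $ j $ j = 0" by auto
      with sym_psd_zero_diagonal [OF insert.prems(1)] have "S $ j = 0" by blast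
      then show ?thesis by (simp add: S'_nth sym [of i j])
    qed
    ultimately obtain v where v: "S' = (\<Sum>j\<in>J. outer (v j))"
      using insert.IH by blast
    have "(\<Sum>j\<in>insert i J. outer ((v(i := u)) j)) = outer u + (\<Sum>j\<in>J. outer (v j))"
    proof -
      have "(\<Sum>j\<in>J. outer ((v(i := u)) j)) = (\<Sum>j\<in>J. outer (v j))"
        using insert.hyps by (intro sum.cong) auto
      then show ?thesis using insert.hyps by simp
    qed
    also have "\<dots> = S" by (simp add: v [symmetric] S'_def)
    finally show ?thesis by (intro exI) (rule HOL.sym)
  qed
qed

text \<open>The sign of \<open>c\<close> is arbitrary, and the characteristic function depends on
  \<open>c\<close> only through its square.\<close>

lemma distr_scaled_std_normal:
  "distr std_normal_distribution borel (\<lambda>x. c * x) = gaussian_real 0 (c\<^sup>2)"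
proof (rule Levy_uniqueness)
  show "real_distribution (distr std_normal_distribution borel (\<lambda>x. c * x))"
    by (intro prob_space.real_distribution_distr prob_space_normal_density) auto
  show "real_distribution (gaussian_real 0 (c\<^sup>2))"
    by (rule real_distribution_gaussian_real) simp
  show "char (distr std_normal_distribution borel (\<lambda>x. c * x)) = char (gaussian_real 0 (c\<^sup>2))"
  proof
    fix t
    have "char (distr std_normal_distribution borel (\<lambda>x. c * x)) t = char std_normal_distribution (t * c)"
      unfolding char_def by (subst integral_distr) (auto simp: mult.assoc)
    also have "\<dots> = exp (of_real (- (t * c)\<^sup>2 / 2))"
      by (simp only: char_std_normal_distribution exp_of_real)
    also have "of_real (- (t * c)\<^sup>2 / 2) = \<i> * of_real (t * 0) - of_real (c\<^sup>2 * t\<^sup>2 / 2)"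
      by (simp add: power_mult_distrib)
    also have "exp \<dots> = char (gaussian_real 0 (c\<^sup>2)) t"
      by (rule char_gaussian_real [symmetric]) simp
    finally show "char (distr std_normal_distribution borel (\<lambda>x. c * x)) t = char (gaussian_real 0 (c\<^sup>2)) t" .
  qed
qed

text \<open>The joint law of the coordinates is the product measure itself, hence the product of
  their individual laws.\<close>

lemma indep_vars_PiM_coordinates:
  assumes "\<And>i. i \<in> I \<Longrightarrow> prob_space (M i)" "I \<noteq> {}"
  shows "prob_space.indep_vars (PiM I M) M (\<lambda>i f. f i) I"
proof -
  interpret P: prob_space "PiM I M"
    using assms(1) by (rule prob_space_PiM)
  have "distr (PiM I M) (PiM I M) (\<lambda>f. \<lambda>i\<in>I. f i) = distr (PiM I M) (PiM I M) (\<lambda>f. f)"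
    by (intro distr_cong) (auto simp: space_PiM PiE_restrict)
  also have "\<dots> = PiM I (\<lambda>i. distr (PiM I M) (M i) (\<lambda>f. f i))"
    using assms(1) by (auto intro!: PiM_cong simp: distr_PiM_component distr_id2)
  finally show ?thesis
    using assms(2) by (subst P.indep_vars_iff_distr_eq_PiM') auto
qed

text \<open>A standard normal multiple of \<open>v i\<close> has covariance
  \<open>outer (v i)\<close>, and independent summands add their covariances. \<open>N\<close> is
  the law of the sum, so the Gaussian vector becomes the identity map.\<close>

lemma gaussian_vec_exists:
  fixes S :: "real^'d^'d"
  assumes "sym_psd S"
  obtains N :: "(real^'d) measure" where "prob_space N" "gaussian_vec N (\<lambda>x. x) 0 S"
proof -
  obtain v :: "'d \<Rightarrow> real^'d" where v: "S = (\<Sum>i\<in>UNIV. outer (v i))"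
    using sym_psd_sum_outer [OF _ assms, of UNIV] by auto
  define P where "P = PiM (UNIV :: 'd set) (\<lambda>_. std_normal_distribution)"
  have std: "prob_space std_normal_distribution"
    by (rule prob_space_normal_density) simp
  interpret P: prob_space P
    unfolding P_def by (intro prob_space_PiM std)
  have coord [measurable]: "(\<lambda>f. f i) \<in> borel_measurable P" for i
  proof -
    have "(\<lambda>f. f i) \<in> measurable P std_normal_distribution"
      unfolding P_def by (rule measurable_component_singleton) simp
    then show ?thesis by simp
  qed
  have "distr P std_normal_distribution (\<lambda>f. f i) = std_normal_distribution" for i
    unfolding P_def by (rule distr_PiM_component) (use std in auto)
  moreover have "distr P std_normal_distribution (\<lambda>f. f i) = distr P borel (\<lambda>f. f i)" for i
    by (rule distr_cong) auto
  ultimately have distr_coord: "distr P borel (\<lambda>f. f i) = std_normal_distribution" for i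
    by simp
  let ?Y = "\<lambda>f. \<Sum>i\<in>UNIV. f i *\<^sub>R v i"
  have "gaussian_vec P ?Y (\<Sum>i\<in>(UNIV::'d set). 0) (\<Sum>i\<in>UNIV. outer (v i))"
  proof (rule P.gaussian_vec_sum)
    have "P.indep_vars (\<lambda>_. std_normal_distribution) (\<lambda>i f. f i) UNIV"
      unfolding P_def by (rule indep_vars_PiM_coordinates) (use std in auto)
    then show "P.indep_vars (\<lambda>_. borel) (\<lambda>i f. f i *\<^sub>R v i) UNIV"
      by (rule P.indep_vars_compose2) auto
    show "gaussian_vec P (\<lambda>f. f i *\<^sub>R v i) 0 (outer (v i))" for i
      unfolding gaussian_vec_def
    proof (intro conjI allI sym_psd_outer)
      show "(\<lambda>f. f i *\<^sub>R v i) \<in> borel_measurable P" by measurable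
      fix a
      have "distr P borel (\<lambda>f. a \<bullet> f i *\<^sub>R v i) = distr (distr P borel (\<lambda>f. f i)) borel (\<lambda>x. (a \<bullet> v i) * x)"
        by (subst distr_distr) (auto simp: comp_def mult.commute)
      then show "distr P borel (\<lambda>f. a \<bullet> f i *\<^sub>R v i) = gaussian_real (a \<bullet> 0) (a \<bullet> (outer (v i) *v a))"
        by (simp add: distr_coord distr_scaled_std_normal quadratic_form_outer)
    qed
  qed simp
  then have Y: "gaussian_vec P ?Y 0 S" by (simp add: v)
  then have [measurable]: "?Y \<in> borel_measurable P" by (simp add: gaussian_vec_def)
  show ?thesis
  proof (rule that)
    show "prob_space (distr P borel ?Y)" by (rule P.prob_space_distr) measurable
    have "distr (distr P borel ?Y) borel (\<lambda>x. a \<bullet> x) = distr P borel (\<lambda>f. a \<bullet> ?Y f)" for a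
      by (subst distr_distr) (auto simp: comp_def)
    then show "gaussian_vec (distr P borel ?Y) (\<lambda>x. x) 0 S"
      using Y by (auto simp: gaussian_vec_def)
  qed
qed

section \<open>The closed loop\<close>

text \<open>The maps \<open>f\<close> and \<open>g j\<close> bring all variables to a common value
  type. Preimages under the composites are preimages under \<open>X\<close> and \<open>Y j\<close>,
  so the generated set systems only shrink.\<close>

lemma (in prob_space) indep_with_seq_imp_indep_vars:
  assumes indep: "indep_with_seq M X Y"
    and f: "f \<in> borel_measurable borel" and g: "\<And>j. g j \<in> borel_measurable borel"
  shows "indep_vars (\<lambda>_. borel) (case_option (\<lambda>w. f (X w)) (\<lambda>j w. g j (Y j w))) UNIV"
  unfolding indep_vars_def2
proof (intro conjI ballI)
  have meas: "X \<in> borel_measurable M" "\<And>j. Y j \<in> borel_measurable M"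
    and sets: "indep_sets (case_option {X -` D \<inter> space M | D. D \<in> sets borel}
          (\<lambda>j. {Y j -` D \<inter> space M | D. D \<in> sets borel})) UNIV"
    using indep by (auto simp: indep_with_seq_def)
  show "random_variable borel (case_option (\<lambda>w. f (X w)) (\<lambda>j w. g j (Y j w)) i)" for i
    using measurable_compose [OF meas(1) f] measurable_compose [OF meas(2) g]
    by (cases i) auto
  have pre: "(\<lambda>w. h (Z w)) -` D \<inter> space M \<in> {Z -` D \<inter> space M | D. D \<in> sets borel}"
    if "h \<in> borel_measurable borel" "D \<in> sets borel" for h :: "'x::topological_space \<Rightarrow> 'y::topological_space" and Z D
    using measurable_sets [OF that] by (auto intro!: exI [of _ "h -` D"])
  show "indep_sets (\<lambda>i. {case_option (\<lambda>w. f (X w)) (\<lambda>j w. g j (Y j w)) i -` D \<inter> space M | D. D \<in> sets borel}) UNIV"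
  proof (rule indep_sets_mono_sets [OF sets])
    fix i :: "nat option"
    show "{case_option (\<lambda>w. f (X w)) (\<lambda>j w. g j (Y j w)) i -` D \<inter> space M | D. D \<in> sets borel}
        \<subseteq> case_option {X -` D \<inter> space M | D. D \<in> sets borel} (\<lambda>j. {Y j -` D \<inter> space M | D. D \<in> sets borel}) i"
    proof (cases i)
      case None
      then show ?thesis using pre [OF f] by auto
    next
      case (Some j)
      then show ?thesis using pre [OF g] by auto
    qed
  qed
qed

text \<open>Unrolling the recursion writes \<open>X j\<close> as an affine image of \<open>Y\<close>
  plus linear images of the first \<open>j\<close> noises. Starting from \<open>T *v Y w + c\<close>
  admits an initial state of larger dimension than \<open>Y\<close>, with singular
  covariance.\<close>

lemma (in prob_space) gaussian_linear_recursion: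
  fixes F :: "real^'d^'d" and G :: "real^'l^'d" and T :: "real^'n^'d"
    and Y :: "'a \<Rightarrow> real^'n" and \<eta> :: "nat \<Rightarrow> 'a \<Rightarrow> real^'l" and X :: "nat \<Rightarrow> 'a \<Rightarrow> real^'d"
  assumes indep: "indep_with_seq M Y \<eta>"
    and Y: "gaussian_vec M Y m S" and \<eta>: "\<And>k. gaussian_vec M (\<eta> k) 0 (\<Gamma> k)"
    and X_0: "\<And>w. w \<in> space M \<Longrightarrow> X 0 w = T *v Y w + c"
    and X_Suc: "\<And>j w. w \<in> space M \<Longrightarrow> X (Suc j) w = F *v X j w + G *v \<eta> j w"
  shows "gaussian_vec M (X j) (matpow F j *v (T *v m + c))
    (matpow F j ** (T ** S ** transpose T) ** matpow (transpose F) j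
      + (\<Sum>k<j. matpow F (j - 1 - k) ** G ** \<Gamma> k ** transpose G ** matpow (transpose F) (j - 1 - k)))"
proof -
  define R where "R k = matpow F (j - 1 - k) ** G" for k
  \<comment> \<open>Index \<open>None\<close> carries the initial state, index \<open>Some k\<close>
    the contribution of noise \<open>k\<close>; \<open>I\<close> below keeps only the noises before
    time \<open>j\<close>.\<close>
  define W where "W = case_option (\<lambda>w. matpow F j *v (T *v Y w + c)) (\<lambda>k w. R k *v \<eta> k w)"
  define \<mu> where "\<mu> = case_option (matpow F j *v (T *v m + c)) (\<lambda>k::nat. 0)"
  define V where "V = case_option (matpow F j ** (T ** S ** transpose T) ** transpose (matpow F j))
    (\<lambda>k. R k ** \<Gamma> k ** transpose (R k))"
  define I where "I = insert None (Some ` {..<j})"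
  have sum_I: "(\<Sum>i\<in>I. f i) = f None + (\<Sum>k<j. f (Some k))" for f :: "nat option \<Rightarrow> 'b::ab_group_add"
    unfolding I_def by (subst sum.insert) (auto simp: sum.reindex)
  have X_eq: "X i w = matpow F i *v (T *v Y w + c) + (\<Sum>k<i. (matpow F (i - 1 - k) ** G) *v \<eta> k w)"
    if w: "w \<in> space M" for i w
  proof (induction i)
    case 0
    then show ?case using X_0 [OF w] by simp
  next
    case (Suc i)
    have "(\<Sum>k<i. (matpow F (Suc i - 1 - k) ** G) *v \<eta> k w) = (\<Sum>k<i. F *v ((matpow F (i - 1 - k) ** G) *v \<eta> k w))"
    proof (rule sum.cong)
      fix k
      assume "k \<in> {..<i}"
      then have "Suc i - 1 - k = Suc (i - 1 - k)" by auto
      then show "(matpow F (Suc i - 1 - k) ** G) *v \<eta> k w = F *v ((matpow F (i - 1 - k) ** G) *v \<eta> k w)"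
        by (simp only: matpow.simps(2) matrix_vector_mul_assoc matrix_mul_assoc)
    qed simp
    also have "\<dots> = F *v (\<Sum>k<i. (matpow F (i - 1 - k) ** G) *v \<eta> k w)"
      by (rule linear_sum [symmetric]) (rule matrix_vector_mul_linear)
    finally show ?case
      by (simp add: X_Suc [OF w] Suc matrix_vector_right_distrib matrix_vector_mul_assoc
          matrix_mul_assoc add.assoc)
  qed
  have "gaussian_vec M (\<lambda>w. \<Sum>i\<in>I. W i w) (\<Sum>i\<in>I. \<mu> i) (\<Sum>i\<in>I. V i)"
  proof (rule gaussian_vec_sum)
    have "(\<lambda>x. matpow F j *v (T *v x + c)) \<in> borel_measurable borel"
      using borel_measurable_matrix_vector_mult [of "matpow F j"] borel_measurable_matrix_vector_mult [of T]
      by measurable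
    then have "indep_vars (\<lambda>_. borel) W UNIV"
      unfolding W_def by (rule indep_with_seq_imp_indep_vars [OF indep]) (rule borel_measurable_matrix_vector_mult)
    then show "indep_vars (\<lambda>_. borel) W I"
      by (rule indep_vars_subset) simp
    show "gaussian_vec M (W i) (\<mu> i) (V i)" for i
    proof (cases i)
      case None
      then show ?thesis
        using gaussian_vec_linear [OF gaussian_vec_affine [OF Y]] by (simp add: W_def \<mu>_def V_def)
    next
      case (Some k)
      then show ?thesis
        using gaussian_vec_linear [OF \<eta>, of "R k" k] by (simp add: W_def \<mu>_def V_def)
    qed
    show "finite I" by (simp add: I_def)
  qed
  moreover have "(\<Sum>i\<in>I. W i w) = X j w" if "w \<in> space M" for w
    by (simp add: sum_I W_def R_def X_eq [OF that])
  ultimately have "gaussian_vec M (X j) (\<Sum>i\<in>I. \<mu> i) (\<Sum>i\<in>I. V i)"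
    by (simp cong: gaussian_vec_cong)
  moreover have "(\<Sum>i\<in>I. \<mu> i) = matpow F j *v (T *v m + c)"
    by (simp add: sum_I \<mu>_def)
  moreover have "(\<Sum>i\<in>I. V i) = matpow F j ** (T ** S ** transpose T) ** matpow (transpose F) j
      + (\<Sum>k<j. matpow F (j - 1 - k) ** G ** \<Gamma> k ** transpose G ** matpow (transpose F) (j - 1 - k))"
    by (simp add: sum_I V_def R_def transpose_matpow matrix_transpose_mul matrix_mul_assoc)
  ultimately show ?thesis by (simp only:)
qed

section \<open>Block vectors, block matrices and one step of the coupled system\<close>

lemma sum_UNIV_sum_type:
  "(\<Sum>i\<in>(UNIV :: ('a::finite + 'b::finite) set). f i) = (\<Sum>a\<in>UNIV. f (Inl a)) + (\<Sum>b\<in>UNIV. f (Inr b))"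
  by (simp add: UNIV_Plus_UNIV [symmetric] sum.Plus del: UNIV_Plus_UNIV)

lemma block_mat_mult_stack_vec:
  "block_mat P Q R S *v stack_vec u v = stack_vec (P *v u + Q *v v) (R *v u + S *v v)"
  by (auto simp: vec_eq_iff block_mat_def stack_vec_def matrix_vector_mult_def sum_UNIV_sum_type
      split: sum.split)

lemma stack_mat_mult_vec: "stack_mat P Q *v u = stack_vec (P *v u) (Q *v u)"
  by (auto simp: vec_eq_iff stack_mat_def stack_vec_def matrix_vector_mult_def split: sum.split)

lemma stack_vec_add: "stack_vec u v + stack_vec u' v' = stack_vec (u + u') (v + v')"
  by (auto simp: vec_eq_iff stack_vec_def split: sum.split)

lemma stack_vec_components: "stack_vec (\<chi> i. x $ Inl i) (\<chi> i. x $ Inr i) = x"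
  by (auto simp: vec_eq_iff stack_vec_def split: sum.split)

text \<open>State and error start as the same random vector up to a constant, so the initial
  covariance has four equal blocks.\<close>

lemma stack_mat_id_congruence:
  fixes S :: "real^'n^'n"
  shows "stack_mat (mat 1) (mat 1) ** S ** transpose (stack_mat (mat 1) (mat 1)) = block_mat S S S S"
proof -
  have "stack_mat (mat 1) (mat 1) ** S = stack_mat S S"
  proof -
    have "(\<Sum>k\<in>UNIV. mat 1 $ i $ k * S $ k $ j) = S $ i $ j" for i j
      using matrix_mul_lid [of S] by (simp add: matrix_matrix_mult_def vec_eq_iff)
    then show ?thesis
      by (auto simp: vec_eq_iff stack_mat_def matrix_matrix_mult_def split: sum.split)
  qed
  moreover have "stack_mat S S ** transpose (stack_mat (mat 1) (mat 1)) = block_mat S S S S"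
    by (auto simp: vec_eq_iff stack_mat_def block_mat_def stack_vec_def matrix_matrix_mult_def
        transpose_def mat_def if_distrib cong: if_cong split: sum.split)
  ultimately show ?thesis by simp
qed

lemma matrix_vector_mult_minus_left: "(- P) *v v = - (P *v (v :: real^'n))"
  using matrix_vector_mult_diff_rdistrib [of 0 P v] by simp

text \<open>Substituting \<open>x = y - (y - x)\<close> in the system and in the difference of
  system and observer yields the four blocks. The noise enters with a plus sign, since the observer
  uses \<open>C *v x - z\<close> and is itself subtracted.\<close>

lemma closed_loop_step:
  "closed_loop dt A B C K L s r *v stack_vec y (y - x) + stack_mat 0 (L r) *v \<eta>
    = stack_vec (disc_A dt (A s) *v y + disc_B dt (A s) B *v (K r *v x))
        (disc_A dt (A s) *v y + disc_B dt (A s) B *v (K r *v x)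
         - (disc_A dt (A r) *v x + disc_B dt (A r) B *v (K r *v x) + L r *v (C *v x - (C *v y + \<eta>))))"
  unfolding closed_loop_def Let_def block_mat_mult_stack_vec stack_mat_mult_vec stack_vec_add
  by (simp add: matrix_vector_mult_add_rdistrib matrix_vector_mult_diff_rdistrib
      matrix_vector_mult_diff_distrib matrix_vector_right_distrib
      matrix_vector_mul_assoc [symmetric] matrix_vector_mult_minus_left algebra_simps)

theorem theorem3p6:
  fixes A :: "real^'p \<Rightarrow> real^'n^'n"
    and B :: "real^'m^'n"
    and C :: "real^'n^'l"
    and dt :: real
    and \<sigma> \<sigma>h :: "real^'p"
    and I I' :: "(real^'p) set"
    and K :: "real^'p \<Rightarrow> real^'n^'m"
    and L :: "real^'p \<Rightarrow> real^'l^'n"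
    and M :: "'w measure"
    and y yh e :: "nat \<Rightarrow> 'w \<Rightarrow> real^'n"
    and z \<eta> :: "nat \<Rightarrow> 'w \<Rightarrow> real^'l"
    and m0 :: "real^'n"
    and C0 :: "real^'n^'n"
    and \<Gamma> :: "nat \<Rightarrow> real^'l^'l"
    and \<Gamma>inf :: "real^'l^'l"
    and X :: "nat \<Rightarrow> 'w \<Rightarrow> real^('n + 'n)"
    and F :: "real^('n + 'n)^('n + 'n)"
    and G :: "real^'l^('n + 'n)"
    and Pcov :: "nat \<Rightarrow> real^('n + 'n)^('n + 'n)"
  assumes dt: "dt > 0"
    and contA: "continuous_on UNIV A"
    and I: "open I" "\<sigma> \<in> I"
    and contK: "continuous_on I K"
    and contL: "continuous_on I L"
    and stabK: "spec_radius (disc_A dt (A \<sigma>) + disc_B dt (A \<sigma>) B ** K \<sigma>) < 1"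
    and stabL: "spec_radius (disc_A dt (A \<sigma>) + L \<sigma> ** C) < 1"
    and I': "I' \<subseteq> I" "\<sigma> \<in> interior I'"
    and stabF: "\<And>\<tau>. \<tau> \<in> I' \<Longrightarrow> spec_radius (closed_loop dt A B C K L \<sigma> \<tau>) < 1"
    and \<sigma>h: "\<sigma>h \<in> I'"
    and M: "prob_space M"
    and y_step: "\<And>j w. w \<in> space M \<Longrightarrow>
          y (Suc j) w = disc_A dt (A \<sigma>) *v y j w + disc_B dt (A \<sigma>) B *v (K \<sigma>h *v yh j w)"
    and z_eq: "\<And>j w. w \<in> space M \<Longrightarrow> z j w = C *v y j w + \<eta> j w"
    and yh_step: "\<And>j w. w \<in> space M \<Longrightarrow>
          yh (Suc j) w = disc_A dt (A \<sigma>h) *v yh j w + disc_B dt (A \<sigma>h) B *v (K \<sigma>h *v yh j w)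
                         + L \<sigma>h *v (C *v yh j w - z j w)"
    and yh_0: "\<And>w. w \<in> space M \<Longrightarrow> yh 0 w = m0"
    and y_0: "gaussian_vec M (y 0) m0 C0"
    and \<Gamma>_pd: "\<And>j. sym_pd (\<Gamma> j)"
    and \<eta>: "\<And>j. gaussian_vec M (\<eta> j) 0 (\<Gamma> j)"
    and indep: "indep_with_seq M (y 0) \<eta>"
    and \<Gamma>_lim: "\<Gamma> \<longlonglongrightarrow> \<Gamma>inf"
    and e_eq: "\<And>j w. w \<in> space M \<Longrightarrow> e j w = y j w - yh j w"
    and X_eq: "\<And>j w. w \<in> space M \<Longrightarrow> X j w = stack_vec (y j w) (e j w)"
    and F_eq: "F = closed_loop dt A B C K L \<sigma> \<sigma>h"
    and G_eq: "G = stack_mat 0 (L \<sigma>h)"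
    and Pcov_eq: "\<And>j. Pcov j = matpow F j ** block_mat C0 C0 C0 C0 ** matpow (transpose F) j
          + (\<Sum>k<j. matpow F (j - 1 - k) ** G ** \<Gamma> k ** transpose G ** matpow (transpose F) (j - 1 - k))"
  shows "(\<forall>j\<ge>1. gaussian_vec M (X j) (matpow F j *v stack_vec m0 0) (Pcov j)) \<and>
    (\<exists>Pinf. Pinf = F ** Pinf ** transpose F + G ** \<Gamma>inf ** transpose G \<and>
       (\<forall>P. P = F ** P ** transpose F + G ** \<Gamma>inf ** transpose G \<longrightarrow> P = Pinf) \<and>
       (\<exists>(N :: (real^('n + 'n)) measure) yinf einf. prob_space N \<and>
          gaussian_vec N (\<lambda>w. stack_vec (yinf w) (einf w)) 0 Pinf \<and>
          gaussian_converges M (\<lambda>j w. stack_vec (y j w) (e j w))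
            N (\<lambda>w. stack_vec (yinf w) (einf w))))"
proof -
  interpret prob_space M by (rule M)
  let ?x0 = "stack_vec m0 0 :: real^('n + 'n)"
  let ?I2 = "stack_mat (mat 1) (mat 1) :: real^'n^('n + 'n)"
  let ?c = "stack_vec 0 (- m0) :: real^('n + 'n)"
  have stable: "spec_radius F < 1"
    using stabF [OF \<sigma>h] by (simp add: F_eq)
  have X_Suc: "X (Suc j) w = F *v X j w + G *v \<eta> j w" if "w \<in> space M" for j w
    unfolding F_eq G_eq X_eq [OF that] e_eq [OF that] closed_loop_step
    by (simp add: y_step [OF that] yh_step [OF that] z_eq [OF that])
  \<comment> \<open>The observer starts at the deterministic value \<open>m0\<close>, so the initial
    error is \<open>y 0 w - m0\<close>.\<close>
  have X_0: "X 0 w = ?I2 *v y 0 w + ?c" if "w \<in> space M" for w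
    by (simp add: X_eq e_eq yh_0 that stack_mat_mult_vec stack_vec_add)
  have mean_0: "?I2 *v m0 + ?c = ?x0"
    by (simp add: stack_mat_mult_vec stack_vec_add)
  \<comment> \<open>Proved for \<open>j = 0\<close> as well, because
    \<open>gaussian_converges\<close> asks for Gaussian vectors at every index.\<close>
  have X_gauss: "gaussian_vec M (X j) (matpow F j *v ?x0) (Pcov j)" for j
    using gaussian_linear_recursion [OF indep y_0 \<eta> X_0 X_Suc, of j]
    unfolding mean_0 stack_mat_id_congruence Pcov_eq .
  obtain Pinf where Pinf: "Pinf = F ** Pinf ** transpose F + G ** \<Gamma>inf ** transpose G"
    and unique: "\<And>P. P = F ** P ** transpose F + G ** \<Gamma>inf ** transpose G \<Longrightarrow> P = Pinf"
    using lyapunov_unique_solution [OF stable, of "G ** \<Gamma>inf ** transpose G"] by blast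
  have Pcov_Suc: "Pcov (Suc j) = F ** Pcov j ** transpose F + G ** \<Gamma> j ** transpose G" for j
    by (rule lyapunov_recursion_sum) (simp only: Pcov_eq matrix_mul_assoc)
  \<comment> \<open>Subtracting the Lyapunov equation leaves a recursion driven by
    \<open>\<Gamma> j - \<Gamma>inf\<close>, which tends to zero.\<close>
  have "(\<lambda>j. Pcov j - Pinf) \<longlonglongrightarrow> 0"
  proof (rule stable_lyapunov_recursion_tendsto_0 [OF stable])
    show "Pcov (Suc j) - Pinf
        = F ** (Pcov j - Pinf) ** transpose F + G ** (\<Gamma> j - \<Gamma>inf) ** transpose G" for j
      using Pinf by (simp add: Pcov_Suc matrix_mult.diff_left matrix_mult.diff_right algebra_simps)
    have "(\<lambda>j. G ** (\<Gamma> j - \<Gamma>inf) ** transpose G) \<longlonglongrightarrow> G ** (\<Gamma>inf - \<Gamma>inf) ** transpose G"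
      by (intro matrix_mult.tendsto tendsto_intros \<Gamma>_lim)
    then show "(\<lambda>j. G ** (\<Gamma> j - \<Gamma>inf) ** transpose G) \<longlonglongrightarrow> 0" by simp
  qed
  then have Pcov_lim: "Pcov \<longlonglongrightarrow> Pinf"
    by (simp add: LIM_zero_iff)
  have "matpow F \<longlonglongrightarrow> 0"
    by (rule matpow_tendsto_0) (use cmod_eigenvalue_le_spec_radius stable in force)
  \<comment> \<open>The product with a vector is written as inner products with the rows, which
    makes its continuity in the matrix visible.\<close>
  then have "(\<lambda>j. \<chi> i. matpow F j $ i \<bullet> ?x0) \<longlonglongrightarrow> (\<chi> i. (0 :: real^('n + 'n)^('n + 'n)) $ i \<bullet> ?x0)"
    by (intro tendsto_intros)
  also have "(\<chi> i. (0 :: real^('n + 'n)^('n + 'n)) $ i \<bullet> ?x0) = 0"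
    by (simp add: vec_eq_iff)
  finally have mean_lim: "(\<lambda>j. matpow F j *v ?x0) \<longlonglongrightarrow> 0"
    by (simp only: matrix_mult_dot)
  have "sym_psd Pinf"
    by (rule sym_psd_limit [OF Pcov_lim]) (use X_gauss in \<open>auto simp: gaussian_vec_def\<close>)
  then obtain N :: "(real^('n + 'n)) measure" where N: "prob_space N" "gaussian_vec N (\<lambda>x. x) 0 Pinf"
    by (rule gaussian_vec_exists)
  \<comment> \<open>The two halves of the identity map on \<open>N\<close>; stacking them again
    gives back the identity.\<close>
  let ?yinf = "\<lambda>x :: real^('n + 'n). \<chi> i. x $ Inl i" and ?einf = "\<lambda>x :: real^('n + 'n). \<chi> i. x $ Inr i"
  have "gaussian_vec M (\<lambda>w. stack_vec (y j w) (e j w)) (matpow F j *v ?x0) (Pcov j)" for j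
    using X_gauss [of j] by (subst gaussian_vec_cong [where Y = "X j"]) (simp_all add: X_eq)
  then have "gaussian_converges M (\<lambda>j w. stack_vec (y j w) (e j w)) N (\<lambda>x. x)"
    unfolding gaussian_converges_def using N(2) mean_lim Pcov_lim
    by (intro exI [of _ "\<lambda>j. matpow F j *v ?x0"] exI [of _ Pcov] exI [of _ 0] exI [of _ Pinf]) simp
  with N have "prob_space N \<and> gaussian_vec N (\<lambda>x. stack_vec (?yinf x) (?einf x)) 0 Pinf \<and>
      gaussian_converges M (\<lambda>j w. stack_vec (y j w) (e j w)) N (\<lambda>x. stack_vec (?yinf x) (?einf x))"
    by (simp add: stack_vec_components)
  then have "\<exists>(N :: (real^('n + 'n)) measure) yinf einf. prob_space N \<and>
      gaussian_vec N (\<lambda>w. stack_vec (yinf w) (einf w)) 0 Pinf \<and>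
      gaussian_converges M (\<lambda>j w. stack_vec (y j w) (e j w)) N (\<lambda>w. stack_vec (yinf w) (einf w))"
    by (intro exI)
  with X_gauss Pinf unique show ?thesis
    by (intro conjI allI impI exI [of _ Pinf])
qed

end
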